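(* Let $G$ be a finite group of order $v$ (not necessarily abelian), and let $k,\lambda$ be positive integers. If for every prime factor $p$ of $v$ there exists a $(p,k,\lambda)$ difference family (respectively, a disjoint $(p,k,\lambda)$ difference family), then there exists a $(v,k,\lambda)$ difference family (respectively, a disjoint $(v,k,\lambda)$ difference family) in $G$.
   Context: Groups are written additively but need not be abelian. For a subset $B$ of a group $G$, $\Delta B$ is the multiset of all differences $b-b'$ of distinct $b,b'\in B$. A $(v,k,\lambda)$ difference family (DF) in a group $G$ of order $v$ is a collection of $k$-subsets of $G$ whose lists of differences together cover every non-zero element of $G$ exactly $\lambda$ times; it is disjoint (DDF) if its members are pairwise disjoint. A $(p,k,\lambda)$-DF means such a family in some group of order $p$ (for $p$ prime, necessarily $\mathbb{Z}_p$).
   Formalization: In the disjoint case it is additionally assumed that v ≤ k whenever λ = k; without this the claim fails (Z_2 is itself a disjoint (2,2,2) family, but Z_4 has no disjoint (4,2,2) family), and a disjoint (v,k,k) family always forces v ≤ k. *)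

theory Defs
  imports "HOL-Algebra.Coset" "HOL-Library.Multiset" "HOL-Computational_Algebra.Primes"
begin

text \<open>
  Groups are the multiplicative ones of HOL-Algebra, so the difference \<open>b - b'\<close> is
  \<open>b \<otimes> inv b'\<close>.
\<close>

definition diff_list :: "('a, 'm) monoid_scheme \<Rightarrow> 'a set \<Rightarrow> 'a multiset" where
  "diff_list G B =
     image_mset (\<lambda>(b, b'). b \<otimes>\<^bsub>G\<^esub> inv\<^bsub>G\<^esub> b') (mset_set {(b, b'). b \<in> B \<and> b' \<in> B \<and> b \<noteq> b'})"

text \<open>A family may contain the same block several times, hence a multiset of blocks.\<close>

definition difference_family ::
  "('a, 'm) monoid_scheme \<Rightarrow> nat \<Rightarrow> nat \<Rightarrow> nat \<Rightarrow> 'a set multiset \<Rightarrow> bool" where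
  "difference_family G v k l F \<longleftrightarrow>
     group G \<and> finite (carrier G) \<and> order G = v \<and>
     (\<forall>B \<in># F. B \<subseteq> carrier G \<and> card B = k) \<and>
     (\<forall>g \<in> carrier G - {\<one>\<^bsub>G\<^esub>}. count (\<Sum>B\<in>#F. diff_list G B) g = l)"

text \<open>The submultiset condition also forbids a nonempty block from occurring twice.\<close>

definition disjoint_difference_family ::
  "('a, 'm) monoid_scheme \<Rightarrow> nat \<Rightarrow> nat \<Rightarrow> nat \<Rightarrow> 'a set multiset \<Rightarrow> bool" where
  "disjoint_difference_family G v k l F \<longleftrightarrow>
     difference_family G v k l F \<and> (\<forall>A B. {#A, B#} \<subseteq># F \<longrightarrow> A \<inter> B = {})"

text \<open>
  Existence in some group of order \<open>v\<close>. Every finite group has an isomorphic copy whose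
  carrier is a set of integers, so fixing the element type loses nothing.
\<close>

definition ex_difference_family :: "nat \<Rightarrow> nat \<Rightarrow> nat \<Rightarrow> bool" where
  "ex_difference_family v k l \<longleftrightarrow> (\<exists>(H :: int monoid) F. difference_family H v k l F)"

definition ex_disjoint_difference_family :: "nat \<Rightarrow> nat \<Rightarrow> nat \<Rightarrow> bool" where
  "ex_disjoint_difference_family v k l \<longleftrightarrow>
     (\<exists>(H :: int monoid) F. disjoint_difference_family H v k l F)"

text \<open>
  The next two facts concern disjoint families with \<open>l = k\<close>. For a prime \<open>p\<close> the cyclic group
  of order \<open>p\<close> itself is the only block of a disjoint \<open>(p, p, p)\<close> family, but a group of order
  \<open>p ^ n\<close> with \<open>n \<ge> 2\<close> has no disjoint \<open>(p ^ n, p, p)\<close> family. Passing from the prime divisors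
  of \<open>v\<close> to a group of order \<open>v\<close> therefore needs \<open>v \<le> k\<close> in case \<open>l = k\<close>.
\<close>

lemma disjoint_difference_family_carrier:
  assumes "group G" "finite (carrier G)" "order G = v"
  shows "disjoint_difference_family G v v v {#carrier G#}"
proof -
  interpret group G by fact
  have "count (diff_list G (carrier G)) g = v" if g: "g \<in> carrier G" "g \<noteq> \<one>\<^bsub>G\<^esub>" for g
  proof -
    let ?P = "{(b, b'). b \<in> carrier G \<and> b' \<in> carrier G \<and> b \<noteq> b'}"
    have fin: "finite ?P"
      by (rule finite_subset[of _ "carrier G \<times> carrier G"]) (use assms in auto)
    have "count (diff_list G (carrier G)) g
        = card {x \<in> ?P. (case x of (b, b') \<Rightarrow> b \<otimes>\<^bsub>G\<^esub> inv\<^bsub>G\<^esub> b') = g}"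
      unfolding diff_list_def using fin
      by (simp add: count_image_mset' sum.If_cases count_mset_set' flip: card_eq_sum)
        (rule arg_cong[where f = card], auto)
    also have "{x \<in> ?P. (case x of (b, b') \<Rightarrow> b \<otimes>\<^bsub>G\<^esub> inv\<^bsub>G\<^esub> b') = g}
        = (\<lambda>b. (g \<otimes>\<^bsub>G\<^esub> b, b)) ` carrier G"
      using g by (auto simp: image_iff m_assoc inv_solve_right' r_cancel_one)
    also have "card \<dots> = v"
      using assms by (simp add: card_image inj_on_def order_def)
    finally show ?thesis .
  qed
  then show ?thesis
    using assms
    by (auto simp: disjoint_difference_family_def difference_family_def order_def
        dest: size_mset_mono)
qed

lemma disjoint_difference_family_order_le:
  assumes ddf: "disjoint_difference_family G v k k F" and "k > 0"
  shows "v \<le> k"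
proof -
  have df: "difference_family G v k k F"
    and disj: "\<And>A B. {#A, B#} \<subseteq># F \<Longrightarrow> A \<inter> B = {}"
    using ddf by (auto simp: disjoint_difference_family_def)
  interpret group G using df by (simp add: difference_family_def)
  have fin: "finite (carrier G)" and v: "card (carrier G) = v"
    using df by (auto simp: difference_family_def order_def)
  have blk: "B \<subseteq> carrier G" "card B = k" "finite B" if "B \<in># F" for B
    using df that fin by (auto simp: difference_family_def intro: finite_subset)
  let ?D = "\<Sum>B\<in>#F. diff_list G B"
  have pairs: "{(b, b'). b \<in> B \<and> b' \<in> B \<and> b \<noteq> b'} = Sigma B (\<lambda>b. B - {b})" for B :: "'a set"
    by auto
  have "size ?D = (\<Sum>B\<in>#F. size (diff_list G B))"
    by (induction F) auto
  also have "\<dots> = (\<Sum>B\<in>#F. k * (k - 1))"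
  proof (rule arg_cong[where f = sum_mset], rule image_mset_cong)
    fix B assume "B \<in># F"
    then show "size (diff_list G B) = k * (k - 1)"
      using blk[of B] unfolding diff_list_def pairs
      by (simp add: card_SigmaI)
  qed
  finally have size1: "size ?D = size F * (k * (k - 1))"
    by simp
  have supp: "set_mset ?D \<subseteq> carrier G - {\<one>\<^bsub>G\<^esub>}"
  proof
    fix x assume "x \<in># ?D"
    then obtain B where B: "B \<in># F" "x \<in># diff_list G B" by auto
    have "finite (Sigma B (\<lambda>b. B - {b}))" using blk[OF B(1)] by auto
    then obtain b b' where "b \<in> B" "b' \<in> B" "b \<noteq> b'" "x = b \<otimes>\<^bsub>G\<^esub> inv\<^bsub>G\<^esub> b'"
      using B(2) unfolding diff_list_def pairs by auto
    moreover from this have "b \<in> carrier G" "b' \<in> carrier G" using blk[OF B(1)] by auto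
    ultimately show "x \<in> carrier G - {\<one>\<^bsub>G\<^esub>}"
      by (auto simp: inv_solve_right')
  qed
  have "size ?D = sum (count ?D) (carrier G - {\<one>\<^bsub>G\<^esub>})"
    unfolding size_multiset_overloaded_eq
    by (rule sum.mono_neutral_left) (use supp fin in \<open>auto simp: count_eq_zero_iff\<close>)
  also have "\<dots> = (\<Sum>g\<in>carrier G - {\<one>\<^bsub>G\<^esub>}. k)"
    by (rule sum.cong) (use df in \<open>auto simp: difference_family_def\<close>)
  also have "\<dots> = (v - 1) * k"
    using fin v by simp
  finally have size2: "size F * (k * (k - 1)) = (v - 1) * k"
    by (rule trans[OF size1[symmetric]])
  have "size F * k \<le> v"
  proof -
    have gen: "card (\<Union>(set_mset E)) = size E * k" if "E \<subseteq># F" for E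
      using that
    proof (induction E)
      case (add A E)
      have A: "A \<in># F" and E: "E \<subseteq># F"
        using add.prems by (auto dest: mset_subset_eqD subset_mset.dual_order.trans
            intro: subset_mset.order_trans[OF _ add.prems])
      have "A \<inter> B = {}" if "B \<in># E" for B
      proof (rule disj)
        have "{#A, B#} \<subseteq># add_mset A E" using that by simp
        then show "{#A, B#} \<subseteq># F" using add.prems by (rule subset_mset.order_trans)
      qed
      then have "A \<inter> \<Union>(set_mset E) = {}" by auto
      moreover have "finite (\<Union>(set_mset E))"
        using blk(3) mset_subset_eqD[OF E] by (intro finite_Union) auto
      ultimately show ?case
        using add.IH[OF E] blk[OF A] by (simp add: card_Un_disjoint)
    qed simp
    have "card (\<Union>(set_mset F)) \<le> card (carrier G)"
      by (rule card_mono) (use blk fin in auto)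
    then show ?thesis using gen[of F] v by simp
  qed
  then have "(v - 1) * k \<le> v * (k - 1)"
    unfolding size2[symmetric] mult.assoc[symmetric] by (rule mult_le_mono1)
  moreover have "v > 0" using fin v by (metis card_gt_0_iff one_closed empty_iff)
  ultimately show ?thesis
    using \<open>k > 0\<close> by (cases v; cases k) (auto simp: algebra_simps)
qed

end

theory Submission
  imports Defs "HOL-Algebra.Elementary_Groups" "HOL-Algebra.Multiplicative_Group"
    "HOL-Number_Theory.Cong"
begin

text \<open>
  Fix a generator of every cyclic subgroup of \<open>G\<close>, and let \<open>dlog x\<close> be the exponent of \<open>x\<close> with
  respect to the generator chosen for \<open>\<langle>x\<rangle>\<close>. Let \<open>p\<close> be the least prime factor of the order of
  \<open>x\<close>. An integer \<open>e \<noteq> 0\<close> with \<open>\<bar>e\<bar> < p\<close> is prime to that order, so raising to the power \<open>e\<close>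
  permutes the generators of \<open>\<langle>x\<rangle>\<close>, and it multiplies their logarithms by \<open>e\<close>. Hence, if \<open>T\<close>
  consists of the elements whose order has least prime factor \<open>p\<close> and whose logarithm is \<open>1\<close>
  modulo \<open>p\<close>, then \<open>x = t\<^sup>e\<close> has a solution \<open>t \<in> T\<close> if and only if \<open>e \<equiv> dlog x\<close> modulo \<open>p\<close>,
  and the solution is unique.

  Given a difference family in \<open>\<int>\<^sub>p\<close>, replace each block \<open>I \<subseteq> [0, p)\<close> by the blocks
  \<open>{t\<^sup>i | i \<in> I}\<close> with \<open>t \<in> T\<close>. The difference of \<open>t\<^sup>i\<close> and \<open>t\<^sup>j\<close> is \<open>t\<close> to the power
  \<open>i - j\<close>, so \<open>x\<close> is a difference of the new blocks as often as \<open>dlog x\<close> is a difference of the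
  given ones. In the same way \<open>x\<close> lies in as many new blocks as \<open>dlog x\<close> in given ones, provided
  that no given block contains \<open>0\<close>. For a disjoint family this is achieved by a translation,
  unless its blocks cover \<open>\<int>\<^sub>p\<close>, and then counting forces \<open>\<lambda> = k\<close>.
\<close>

section \<open>Multisets\<close>

lemma in_mset_setD: "x \<in># mset_set A \<Longrightarrow> x \<in> A"
  by (cases "finite A") (auto simp: infinite_set_mset_mset_set)

lemma sum_mset_sum: "(\<Sum>x\<in>#(\<Sum>t\<in>T. M t). f x) = (\<Sum>t\<in>T. \<Sum>x\<in>#M t. f x)"
  by (induction T rule: infinite_finite_induct) auto

lemma count_image_mset_inj_on:
  assumes "inj_on f A" "set_mset M \<subseteq> A" "x \<in> A"
  shows "count (image_mset f M) (f x) = count M x"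
  using assms(2) by (induction M) (use assms(1,3) in \<open>auto dest: inj_onD\<close>)

abbreviation family_points :: "'a set multiset \<Rightarrow> 'a multiset" where
  "family_points F \<equiv> \<Sum>B\<in>#F. mset_set B"

lemma pairwise_disjoint_mset_iff_count:
  assumes "\<And>B. B \<in># F \<Longrightarrow> finite B"
  shows "(\<forall>A B. {#A, B#} \<subseteq># F \<longrightarrow> A \<inter> B = {}) \<longleftrightarrow> (\<forall>x. count (family_points F) x \<le> 1)"
proof (intro iffI allI impI)
  fix x
  assume "\<forall>A B. {#A, B#} \<subseteq># F \<longrightarrow> A \<inter> B = {}"
  then show "count (family_points F) x \<le> 1"
    using assms
  proof (induction F)
    case (add A F)
    have "{#B, C#} \<subseteq># add_mset A F" if "{#B, C#} \<subseteq># F" for B C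
      using that by (rule subset_mset.order_trans) simp
    then have "count (family_points F) x \<le> 1"
      using add by auto
    moreover have "count (family_points F) x = 0" if "x \<in> A"
    proof -
      have "A \<inter> B = {}" if "B \<in># F" for B
        using add.prems(1) that by simp
      then have "x \<notin># mset_set B" if "B \<in># F" for B
        using \<open>x \<in> A\<close> that by (auto dest: in_mset_setD)
      then show ?thesis
        by (auto simp: count_eq_zero_iff)
    qed
    ultimately show ?case
      using add.prems(2) by (simp add: count_mset_set')
  qed simp
next
  fix A B
  assume count_le: "\<forall>x. count (family_points F) x \<le> 1" and subset: "{#A, B#} \<subseteq># F"
  obtain E where F: "F = {#A, B#} + E"
    using subset by (auto simp: subset_mset.le_iff_add)
  have "\<not> (x \<in> A \<and> x \<in> B)" for x
    using count_le[rule_format, of x] assms[of A] assms[of B] by (auto simp: F count_mset_set')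
  then show "A \<inter> B = {}"
    by blast
qed

section \<open>Difference families\<close>

abbreviation family_diffs :: "('a, 'm) monoid_scheme \<Rightarrow> 'a set multiset \<Rightarrow> 'a multiset" where
  "family_diffs G F \<equiv> \<Sum>B\<in>#F. diff_list G B"

lemma size_diff_list:
  assumes "finite B"
  shows "size (diff_list G B) = card B * (card B - 1)"
proof -
  have "{(b, b'). b \<in> B \<and> b' \<in> B \<and> b \<noteq> b'} = Sigma B (\<lambda>b. B - {b})"
    by auto
  then show ?thesis
    using assms by (simp add: diff_list_def card_SigmaI)
qed

lemma diff_list_elem:
  assumes "x \<in># diff_list G B"
  obtains b b' where "b \<in> B" "b' \<in> B" "b \<noteq> b'" "x = b \<otimes>\<^bsub>G\<^esub> inv\<^bsub>G\<^esub> b'"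
  using assms by (auto simp: diff_list_def dest!: in_mset_setD)

lemma diff_list_image:
  assumes inj: "inj_on f B"
    and diff: "\<And>b b'. b \<in> B \<Longrightarrow> b' \<in> B \<Longrightarrow>
                 f b \<otimes>\<^bsub>H\<^esub> inv\<^bsub>H\<^esub> f b' = h (b \<otimes>\<^bsub>G\<^esub> inv\<^bsub>G\<^esub> b')"
  shows "diff_list H (f ` B) = image_mset h (diff_list G B)"
proof -
  let ?P = "\<lambda>B. {(b, b'). b \<in> B \<and> b' \<in> B \<and> b \<noteq> b'}"
  have "inj_on (map_prod f f) (?P B)"
    by (rule inj_on_subset[OF map_prod_inj_on[OF inj inj]]) auto
  moreover have "map_prod f f ` ?P B = ?P (f ` B)"
    using inj by (force simp: inj_on_eq_iff)
  ultimately have "mset_set (?P (f ` B)) = image_mset (map_prod f f) (mset_set (?P B))"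
    by (simp add: image_mset_mset_set)
  then show ?thesis
    unfolding diff_list_def
    by (auto simp: image_mset.compositionality diff dest!: in_mset_setD intro!: image_mset_cong)
qed

lemma family_diffs_image:
  assumes "\<And>B. B \<in># F \<Longrightarrow> inj_on f B"
    and "\<And>B b b'. B \<in># F \<Longrightarrow> b \<in> B \<Longrightarrow> b' \<in> B \<Longrightarrow>
           f b \<otimes>\<^bsub>H\<^esub> inv\<^bsub>H\<^esub> f b' = h (b \<otimes>\<^bsub>G\<^esub> inv\<^bsub>G\<^esub> b')"
  shows "family_diffs H (image_mset ((`) f) F) = image_mset h (family_diffs G F)"
  using assms
proof (induction F)
  case (add B F)
  have "diff_list H (f ` B) = image_mset h (diff_list G B)"
    using add.prems by (intro diff_list_image) auto
  moreover have "family_diffs H (image_mset ((`) f) F) = image_mset h (family_diffs G F)"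
    using add.prems by (intro add.IH) auto
  ultimately show ?case
    by simp
qed simp

lemma family_points_image:
  assumes "\<And>B. B \<in># F \<Longrightarrow> inj_on f B"
  shows "family_points (image_mset ((`) f) F) = image_mset f (family_points F)"
  using assms by (induction F) (auto simp: image_mset_mset_set)

lemma set_family_points:
  assumes "\<And>B. B \<in># F \<Longrightarrow> B \<subseteq> A"
  shows "set_mset (family_points F) \<subseteq> A"
  using assms by (auto dest: in_mset_setD)

lemma (in group) set_family_diffs:
  assumes "\<And>B. B \<in># F \<Longrightarrow> B \<subseteq> carrier G"
  shows "set_mset (family_diffs G F) \<subseteq> carrier G - {\<one>}"
proof
  fix x
  assume "x \<in># family_diffs G F"
  then obtain B b b' where B: "B \<in># F" "b \<in> B" "b' \<in> B" "b \<noteq> b'" "x = b \<otimes> inv b'"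
    by (auto elim: diff_list_elem)
  then have "b \<in> carrier G" "b' \<in> carrier G"
    using assms by auto
  then show "x \<in> carrier G - {\<one>}"
    using B(4,5) by (auto simp: inv_solve_right')
qed

lemma
  assumes "difference_family G v k l F"
  shows difference_family_group: "group G"
    and difference_family_finite_carrier: "finite (carrier G)"
    and difference_family_order: "order G = v"
    and difference_family_block_subset: "\<And>B. B \<in># F \<Longrightarrow> B \<subseteq> carrier G"
    and difference_family_card_block: "\<And>B. B \<in># F \<Longrightarrow> card B = k"
    and difference_family_finite_block: "\<And>B. B \<in># F \<Longrightarrow> finite B"
    and difference_family_count_diffs:
      "\<And>g. g \<in> carrier G - {\<one>\<^bsub>G\<^esub>} \<Longrightarrow> count (family_diffs G F) g = l"
  using assms finite_subset unfolding difference_family_def by blast+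

lemma disjoint_difference_family_iff_count:
  "disjoint_difference_family G v k l F \<longleftrightarrow>
     difference_family G v k l F \<and> (\<forall>x. count (family_points F) x \<le> 1)"
  unfolding disjoint_difference_family_def
  using pairwise_disjoint_mset_iff_count[of F] difference_family_finite_block by blast

lemma difference_family_size:
  assumes df: "difference_family G v k l F"
  shows "size F * (k * (k - 1)) = l * (v - 1)"
proof -
  interpret group G
    using df by (rule difference_family_group)
  note finite_carrier = difference_family_finite_carrier[OF df]
  have support: "set_mset (family_diffs G F) \<subseteq> carrier G - {\<one>\<^bsub>G\<^esub>}"
    using difference_family_block_subset[OF df] by (rule set_family_diffs)
  have "size F * (k * (k - 1)) = (\<Sum>B\<in>#F. size (diff_list G B))"
    by (simp add: size_diff_list difference_family_card_block[OF df]
        difference_family_finite_block[OF df] cong: image_mset_cong)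
  also have "\<dots> = size (family_diffs G F)"
    by (induction F) auto
  also have "\<dots> = (\<Sum>g\<in>carrier G - {\<one>\<^bsub>G\<^esub>}. count (family_diffs G F) g)"
    unfolding size_multiset_overloaded_eq using finite_carrier support
    by (intro sum.mono_neutral_left) (auto simp: count_eq_zero_iff simp del: set_mset_Union_mset)
  also have "\<dots> = l * (v - 1)"
    using finite_carrier difference_family_order[OF df] difference_family_count_diffs[OF df]
    by (simp add: order_def)
  finally show ?thesis .
qed

lemma difference_family_block_size_le:
  assumes df: "difference_family G v k l F" and "l > 0" "v > 1"
  shows "k \<le> v"
proof -
  have "size F \<noteq> 0"
    using difference_family_size[OF df] assms(2,3) by (intro notI) simp
  then obtain B where "B \<in># F"
    by auto
  then have "B \<subseteq> carrier G" "card B = k"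
    using df by (auto dest: difference_family_block_subset difference_family_card_block)
  then show ?thesis
    using card_mono[of "carrier G" B] difference_family_finite_carrier[OF df]
      difference_family_order[OF df] by (simp add: order_def)
qed

lemma disjoint_difference_family_covering_size:
  assumes ddf: "disjoint_difference_family G v k l F" and covering: "carrier G \<subseteq> \<Union>(set_mset F)"
  shows "size F * k = v"
proof -
  have df: "difference_family G v k l F" and count_le: "count (family_points F) x \<le> 1" for x
    using ddf by (auto simp: disjoint_difference_family_iff_count)
  note finite_carrier = difference_family_finite_carrier[OF df]
  have in_points_iff: "x \<in># family_points F \<longleftrightarrow> x \<in> carrier G" for x
    using covering difference_family_block_subset[OF df]
    by (auto simp: difference_family_finite_block[OF df])
  have "family_points F = mset_set (carrier G)"
  proof (rule multiset_eqI)
    fix x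
    show "count (family_points F) x = count (mset_set (carrier G)) x"
      using in_points_iff[of x] count_le[of x] finite_carrier
      unfolding count_greater_zero_iff[symmetric]
      by (cases "x \<in> carrier G") (auto simp del: count_greater_zero_iff)
  qed
  moreover have "size (family_points F) = (\<Sum>B\<in>#F. card B)"
    by (induction F) auto
  moreover have "(\<Sum>B\<in>#F. card B) = size F * k"
    by (simp add: difference_family_card_block[OF df] cong: image_mset_cong)
  ultimately show ?thesis
    using difference_family_order[OF df] by (simp add: order_def)
qed

lemma disjoint_difference_family_covering_imp_eq:
  assumes ddf: "disjoint_difference_family G v k l F" and covering: "carrier G \<subseteq> \<Union>(set_mset F)"
    and "v > 1" "l > 0"
  shows "l = k"
proof -
  have df: "difference_family G v k l F"
    using ddf by (simp add: disjoint_difference_family_def)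
  have eq: "v * (k - 1) = l * (v - 1)"
    using difference_family_size[OF df] disjoint_difference_family_covering_size[OF ddf covering]
    by (metis mult.assoc)
  have "coprime v (v - 1)"
    using \<open>v > 1\<close> by (intro coprime_diff_one_right_nat) simp
  moreover have "v dvd l * (v - 1)"
    by (simp only: eq[symmetric] dvd_triv_left)
  ultimately have "v dvd l"
    by (simp add: coprime_dvd_mult_left_iff)
  then obtain m where l: "l = v * m" ..
  then have k: "k - 1 = m * (v - 1)"
    using eq \<open>v > 1\<close> by simp
  have "k - 1 \<le> v - 1"
    using difference_family_block_size_le[OF df \<open>l > 0\<close> \<open>v > 1\<close>] by simp
  then have "m * (v - 1) \<le> 1 * (v - 1)"
    by (simp only: k mult_1)
  then have "m \<le> 1"
    using \<open>v > 1\<close> by (simp only: mult_le_cancel2)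
  then have "m = 1"
    using l \<open>l > 0\<close> by (cases m) auto
  then show ?thesis
    using l k \<open>v > 1\<close> by simp
qed

section \<open>Affine images\<close>

lemma (in group_hom) affine_diff:
  assumes "x \<in> carrier G" "x' \<in> carrier G" "y \<in> carrier H"
  shows "(h x \<otimes>\<^bsub>H\<^esub> y) \<otimes>\<^bsub>H\<^esub> inv\<^bsub>H\<^esub> (h x' \<otimes>\<^bsub>H\<^esub> y) = h (x \<otimes> inv x')"
  using assms by (simp add: H.inv_mult_group flip: H.m_assoc) (simp add: H.m_assoc)

lemma (in group_hom) inj_on_affine:
  assumes "inj_on h (carrier G)" "y \<in> carrier H"
  shows "inj_on (\<lambda>x. h x \<otimes>\<^bsub>H\<^esub> y) (carrier G)"
  using assms by (auto simp: inj_on_def)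

lemma (in group_hom) affine_eq_one_iff:
  assumes "inj_on h (carrier G)" "x \<in> carrier G" "y \<in> carrier G"
  shows "h x \<otimes>\<^bsub>H\<^esub> inv\<^bsub>H\<^esub> h y = \<one>\<^bsub>H\<^esub> \<longleftrightarrow> x = y"
  using assms H.inv_solve_right'[of "\<one>\<^bsub>H\<^esub>" "h x" "h y"] by (auto dest: inj_onD)

lemma iso_imp_group_hom:
  "group G \<Longrightarrow> group H \<Longrightarrow> h \<in> iso G H \<Longrightarrow> group_hom G H h"
  by (simp add: group_hom_def group_hom_axioms_def iso_def)

lemma difference_family_affine:
  assumes df: "difference_family G v k l F"
    and H: "group H" and h: "h \<in> iso G H" and y: "y \<in> carrier H"
  shows "difference_family H v k l (image_mset ((`) (\<lambda>x. h x \<otimes>\<^bsub>H\<^esub> y)) F)"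
    (is "difference_family H v k l (image_mset ((`) ?f) F)")
proof -
  interpret h: group_hom G H h
    using iso_imp_group_hom[OF difference_family_group[OF df] H h] .
  have inj_h: "inj_on h (carrier G)" and surj_h: "h ` carrier G = carrier H"
    using h by (auto simp: iso_def bij_betw_def)
  note block_subset = difference_family_block_subset[OF df]
  have inj_f: "inj_on ?f B" if "B \<in># F" for B
    using h.inj_on_affine[OF inj_h y] block_subset[OF that] by (rule inj_on_subset)
  have diff_f: "?f b \<otimes>\<^bsub>H\<^esub> inv\<^bsub>H\<^esub> ?f b' = h (b \<otimes>\<^bsub>G\<^esub> inv\<^bsub>G\<^esub> b')"
    if "B \<in># F" "b \<in> B" "b' \<in> B" for B b b'
    using that block_subset y by (intro h.affine_diff) auto
  have "count (family_diffs H (image_mset ((`) ?f) F)) g = l"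
    if g: "g \<in> carrier H - {\<one>\<^bsub>H\<^esub>}" for g
  proof -
    obtain a where a: "a \<in> carrier G - {\<one>\<^bsub>G\<^esub>}" "g = h a"
      using g surj_h h.hom_one by (metis DiffD1 DiffD2 DiffI imageE singletonD singletonI)
    have "count (image_mset h (family_diffs G F)) (h a) = count (family_diffs G F) a"
      using h.G.set_family_diffs[of F] block_subset a(1)
      by (intro count_image_mset_inj_on[OF inj_h]) auto
    then show ?thesis
      using family_diffs_image[of F ?f H h G, OF inj_f diff_f] a
      by (simp add: difference_family_count_diffs[OF df])
  qed
  moreover have "?f ` B \<subseteq> carrier H" "card (?f ` B) = k" if "B \<in># F" for B
    using block_subset[OF that] difference_family_card_block[OF df that] y
    by (auto simp: card_image[OF inj_f[OF that]])
  moreover have "finite (carrier H)" "order H = v"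
    using difference_family_finite_carrier[OF df] difference_family_order[OF df] inj_h
    by (auto simp: order_def card_image simp flip: surj_h)
  ultimately show ?thesis
    using H by (simp add: difference_family_def)
qed

lemma disjoint_difference_family_affine:
  assumes ddf: "disjoint_difference_family G v k l F"
    and H: "group H" and h: "h \<in> iso G H" and y: "y \<in> carrier H"
  shows "disjoint_difference_family H v k l (image_mset ((`) (\<lambda>x. h x \<otimes>\<^bsub>H\<^esub> y)) F)"
    (is "disjoint_difference_family H v k l (image_mset ((`) ?f) F)")
proof -
  have df: "difference_family G v k l F" and count_le: "count (family_points F) x \<le> 1" for x
    using ddf by (auto simp: disjoint_difference_family_iff_count)
  note block_subset = difference_family_block_subset[OF df]
  interpret h: group_hom G H h
    using iso_imp_group_hom[OF difference_family_group[OF df] H h] .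
  have inj_f: "inj_on ?f (carrier G)"
    using h y by (intro h.inj_on_affine) (auto simp: iso_def bij_betw_def)
  have points_f: "family_points (image_mset ((`) ?f) F) = image_mset ?f (family_points F)"
    using block_subset by (intro family_points_image inj_on_subset[OF inj_f])
  have points: "set_mset (family_points F) \<subseteq> carrier G"
    using block_subset by (rule set_family_points)
  have "count (image_mset ?f (family_points F)) z \<le> 1" for z
  proof (cases "z \<in># image_mset ?f (family_points F)")
    case True
    then obtain x where "x \<in># family_points F" "z = ?f x"
      by auto
    then show ?thesis
      using count_image_mset_inj_on[OF inj_f points] points count_le by auto
  next
    case False
    then show ?thesis
      by (metis not_in_iff zero_le)
  qed
  then show ?thesis
    using difference_family_affine[OF df H h y]
    by (simp add: disjoint_difference_family_iff_count points_f)
qed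

section \<open>Cyclic groups\<close>

context group
begin

lemma int_pow_eq_iff_cong:
  "x \<in> carrier G \<Longrightarrow> x [^] (i::int) = x [^] j \<longleftrightarrow> [i = j] (mod int (ord x))"
  by (simp add: int_pow_eq cong_iff_dvd_diff dvd_diff_commute)

lemma inj_on_int_pow_ord:
  assumes "x \<in> carrier G"
  shows "inj_on (\<lambda>i::int. x [^] i) {0..<int (ord x)}"
  by (rule inj_onI) (auto simp: int_pow_eq_iff_cong[OF assms] cong_def)

lemma int_pow_iso_integer_mod_group:
  assumes "finite (carrier G)" and x: "x \<in> carrier G" and ord: "ord x = order G"
  shows "(\<lambda>i::int. x [^] i) \<in> iso (integer_mod_group (order G)) G"
proof (rule isoI)
  have carrier: "carrier (integer_mod_group (order G)) = {0..<int (order G)}"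
    using assms(1) order_gt_0_iff_finite by (simp add: carrier_integer_mod_group)
  show "(\<lambda>i::int. x [^] i) \<in> hom (integer_mod_group (order G)) G"
  proof (rule homI)
    fix i j :: int
    have "x [^] ((i + j) mod int (order G)) = x [^] (i + j)"
      using x by (simp add: int_pow_eq_iff_cong ord)
    then show "x [^] (i \<otimes>\<^bsub>integer_mod_group (order G)\<^esub> j) = x [^] i \<otimes> x [^] j"
      using x by (simp add: int_pow_mult)
  qed (use x in simp)
  have inj: "inj_on (\<lambda>i::int. x [^] i) {0..<int (order G)}"
    using inj_on_int_pow_ord[OF x] by (simp add: ord)
  have "card ((\<lambda>i::int. x [^] i) ` {0..<int (order G)}) = card (carrier G)"
    using card_image[OF inj] by (simp add: order_def)
  then have "(\<lambda>i::int. x [^] i) ` {0..<int (order G)} = carrier G"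
    using assms(1) x by (intro card_subset_eq) auto
  then show "bij_betw (\<lambda>i::int. x [^] i) (carrier (integer_mod_group (order G))) (carrier G)"
    using inj by (simp add: bij_betw_def carrier)
qed

lemma prime_order_iso_integer_mod_group:
  assumes "prime (order G)"
  obtains h where "h \<in> iso G (integer_mod_group (order G))"
proof -
  have fin: "finite (carrier G)"
    using prime_gt_0_nat[OF assms] order_gt_0_iff_finite by blast
  have "card (carrier G) \<noteq> 1"
    using prime_gt_1_nat[OF assms] by (simp add: order_def)
  then obtain x where x: "x \<in> carrier G" "x \<noteq> \<one>"
    using one_closed by (metis is_singletonI' is_singleton_altdef empty_iff)
  have "ord x = order G"
    using ord_dvd_group_order[OF x(1)] ord_eq_1[OF x(1)] x(2) assms by (auto simp: prime_nat_iff)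
  then have "integer_mod_group (order G) \<cong> G"
    by (rule is_isoI[OF int_pow_iso_integer_mod_group[OF fin x(1)]])
  then have "G \<cong> integer_mod_group (order G)"
    by (rule group.iso_sym[OF group_integer_mod_group])
  then show ?thesis
    using that by (auto simp: is_iso_def)
qed

end

lemma family_diffs_integer_mod_group:
  assumes "\<And>I. I \<in># F \<Longrightarrow> I \<subseteq> carrier (integer_mod_group n)"
  shows "family_diffs (integer_mod_group n) F =
           image_mset (\<lambda>e. e mod int n) (family_diffs integer_group F)"
proof -
  have "i \<otimes>\<^bsub>integer_mod_group n\<^esub> inv\<^bsub>integer_mod_group n\<^esub> j =
      (i \<otimes>\<^bsub>integer_group\<^esub> inv\<^bsub>integer_group\<^esub> j) mod int n"
    if "I \<in># F" "i \<in> I" "j \<in> I" for I i j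
  proof -
    have "j \<in> carrier (integer_mod_group n)"
      using assms that by auto
    then show ?thesis
      by (simp add: mod_add_right_eq)
  qed
  then have "family_diffs (integer_mod_group n) (image_mset ((`) id) F) =
      image_mset (\<lambda>e. e mod int n) (family_diffs integer_group F)"
    by (intro family_diffs_image) auto
  then show ?thesis
    by simp
qed

lemma difference_family_integer_mod_group_block_subset:
  assumes "difference_family (integer_mod_group n) v k l F" "I \<in># F"
  shows "I \<subseteq> {0..<int n}"
  using difference_family_finite_carrier[OF assms(1)] difference_family_block_subset[OF assms]
  by (auto simp: carrier_integer_mod_group infinite_UNIV_int split: if_splits)

lemma ex_difference_family_integer_mod_group:
  assumes "ex_difference_family p k l" "prime p"
  obtains F where "difference_family (integer_mod_group p) p k l F"
proof -
  obtain H :: "int monoid" and F where df: "difference_family H p k l F"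
    using assms(1) by (auto simp: ex_difference_family_def)
  interpret H: group H
    using df by (rule difference_family_group)
  obtain h where "h \<in> iso H (integer_mod_group p)"
    using H.prime_order_iso_integer_mod_group assms(2) difference_family_order[OF df] by auto
  then show ?thesis
    using difference_family_affine[OF df group_integer_mod_group] integer_mod_group_0 that by blast
qed

lemma ex_disjoint_difference_family_integer_mod_group:
  assumes "ex_disjoint_difference_family p k l" "prime p" "l > 0" "l \<noteq> k"
  obtains F where "disjoint_difference_family (integer_mod_group p) p k l F"
    and "\<And>I. I \<in># F \<Longrightarrow> 0 \<notin> I"
proof -
  let ?Z = "integer_mod_group p"
  obtain H :: "int monoid" and F where ddf: "disjoint_difference_family H p k l F"
    using assms(1) by (auto simp: ex_disjoint_difference_family_def)
  then have df: "difference_family H p k l F"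
    by (simp add: disjoint_difference_family_def)
  have "group H"
    using df by (rule difference_family_group)
  then obtain h where h: "h \<in> iso H ?Z"
    using group.prime_order_iso_integer_mod_group assms(2) difference_family_order[OF df] by metis
  interpret h: group_hom H ?Z h
    using iso_imp_group_hom[OF \<open>group H\<close> group_integer_mod_group h] .
  have "\<not> carrier H \<subseteq> \<Union>(set_mset F)"
    using disjoint_difference_family_covering_imp_eq[OF ddf] prime_gt_1_nat[OF assms(2)] assms(3,4)
    by blast
  then obtain y where y: "y \<in> carrier H" "\<And>B. B \<in># F \<Longrightarrow> y \<notin> B"
    by blast
  let ?f = "\<lambda>x. h x \<otimes>\<^bsub>?Z\<^esub> inv\<^bsub>?Z\<^esub> h y"
  have "inj_on h (carrier H)"
    using h by (simp add: iso_def bij_betw_def)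
  then have "?f x \<noteq> \<one>\<^bsub>?Z\<^esub>" if "B \<in># F" "x \<in> B" for B x
    using that y difference_family_block_subset[OF df that(1)] h.affine_eq_one_iff by blast
  then have "\<one>\<^bsub>?Z\<^esub> \<notin> ?f ` B" if "B \<in># F" for B
    using that by (metis (no_types, lifting) imageE)
  then have "0 \<notin> I" if "I \<in># image_mset ((`) ?f) F" for I
    using that by auto
  moreover have "disjoint_difference_family ?Z p k l (image_mset ((`) ?f) F)"
    using ddf group_integer_mod_group h h.H.inv_closed[OF h.hom_closed[OF y(1)]]
    by (rule disjoint_difference_family_affine)
  ultimately show ?thesis
    by (intro that)
qed

section \<open>Powers with small exponents\<close>

definition least_prime_factor :: "nat \<Rightarrow> nat" where
  "least_prime_factor n = (LEAST q. prime q \<and> q dvd n)"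

lemma
  assumes "n \<noteq> 1"
  shows prime_least_prime_factor: "prime (least_prime_factor n)"
    and least_prime_factor_dvd: "least_prime_factor n dvd n"
proof -
  have "prime (least_prime_factor n) \<and> least_prime_factor n dvd n"
    unfolding least_prime_factor_def by (rule LeastI_ex) (rule prime_factor_nat[OF assms])
  then show "prime (least_prime_factor n)" "least_prime_factor n dvd n"
    by auto
qed

lemma coprime_if_less_least_prime_factor:
  fixes e :: int
  assumes "e \<noteq> 0" "\<bar>e\<bar> < int (least_prime_factor n)"
  shows "coprime e (int n)"
proof (rule ccontr)
  assume "\<not> coprime e (int n)"
  then have "nat (gcd e (int n)) \<noteq> 1"
    by (simp add: coprime_iff_gcd_eq_1 nat_eq_iff)
  then obtain q where q: "prime q" "q dvd nat (gcd e (int n))"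
    using prime_factor_nat by blast
  have "int q dvd gcd e (int n)"
    using q(2) by (metis gcd_ge_0_int int_dvd_int_iff int_nat_eq)
  then have "int q dvd e" "q dvd n"
    by auto
  then have "int q \<le> \<bar>e\<bar>" "least_prime_factor n \<le> q"
    using assms(1) q(1) unfolding least_prime_factor_def
    by (auto intro: zdvd_imp_le Least_le)
  then show False
    using assms(2) by linarith
qed

context group
begin

lemma generate_int_pow_eq_iff:
  assumes x: "x \<in> carrier G"
  shows "generate G {x [^] (e::int)} = generate G {x} \<longleftrightarrow> coprime e (int (ord x))"
proof -
  have "generate G {x [^] e} \<subseteq> generate G {x}"
    using x by (intro generate_subgroup_incl generate_is_subgroup) (auto simp: generate_pow)
  moreover have "generate G {x} \<subseteq> generate G {x [^] e} \<longleftrightarrow> x \<in> generate G {x [^] e}"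
    using x generate_subgroup_incl[OF _ generate_is_subgroup, of "{x}" "{x [^] e}"]
    by (auto simp: generate.incl)
  moreover have "x \<in> generate G {x [^] e} \<longleftrightarrow> (\<exists>f::int. x [^] (e * f) = x [^] (1::int))"
    using x by (simp add: generate_pow int_pow_pow) metis
  ultimately show ?thesis
    by (simp only: int_pow_eq_iff_cong[OF x] coprime_iff_invertible_int set_eq_subset simp_thms)
qed

lemma ord_eq_if_generate_eq:
  "x \<in> carrier G \<Longrightarrow> y \<in> carrier G \<Longrightarrow> generate G {x} = generate G {y} \<Longrightarrow> ord x = ord y"
  by (simp add: generate_pow_card)

lemma ord_int_pow_coprime:
  assumes "x \<in> carrier G" "coprime (e::int) (int (ord x))"
  shows "ord (x [^] e) = ord x"
  using assms by (intro ord_eq_if_generate_eq) (auto simp: generate_int_pow_eq_iff)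

lemma bij_betw_int_pow_coprime:
  fixes e :: int
  defines "X \<equiv> {x \<in> carrier G. coprime e (int (ord x))}"
  shows "bij_betw (\<lambda>x. x [^] e) X X"
proof -
  have "\<exists>f. coprime f n \<and> [e * f = 1] (mod n)" if "coprime e n" for n
    using that by (metis coprime_iff_invertible_int mult.commute)
  then obtain f where f: "coprime (f n) n" "[e * f n = 1] (mod n)" if "coprime e n" for n
    by metis
  define root where "root x = x [^] f (int (ord x))" for x
  have ord_pow: "ord (x [^] e) = ord x" and ord_root: "ord (root x) = ord x" if "x \<in> X" for x
    using that f(1) by (auto simp: X_def root_def ord_int_pow_coprime)
  have inverse: "x [^] (e * f (int (ord x))) = x" if "x \<in> X" for x
  proof -
    have "x [^] (e * f (int (ord x))) = x [^] (1::int)"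
      using that f(2) by (simp only: X_def mem_Collect_eq int_pow_eq_iff_cong)
    then show ?thesis
      using that by (simp add: X_def)
  qed
  have "root (x [^] e) = x" "root x [^] e = x" if "x \<in> X" for x
    using that ord_pow[OF that] inverse[OF that]
    by (simp_all add: root_def X_def int_pow_pow mult.commute)
  moreover have "x [^] e \<in> X" "root x \<in> X" if "x \<in> X" for x
    using that ord_pow[OF that] ord_root[OF that] by (auto simp: X_def root_def)
  ultimately show ?thesis
    by (intro bij_betw_byWitness[where f' = root]) auto
qed

abbreviation lpf_ord :: "'a \<Rightarrow> nat" where
  "lpf_ord x \<equiv> least_prime_factor (ord x)"

lemma
  assumes "x \<in> carrier G - {\<one>}"
  shows prime_lpf_ord: "prime (lpf_ord x)" and lpf_ord_dvd_ord: "lpf_ord x dvd ord x"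
  using assms ord_eq_1[of x] prime_least_prime_factor least_prime_factor_dvd by auto

lemma int_pow_neq_one_if_less_lpf_ord:
  assumes "x \<in> carrier G - {\<one>}" "e \<noteq> 0" "\<bar>e\<bar> < int (lpf_ord x)"
  shows "x [^] (e::int) \<noteq> \<one>"
  using assms coprime_if_less_least_prime_factor[of e "ord x"] ord_int_pow_coprime[of x e] ord_eq_1
  by fastforce

lemma inj_on_int_pow_lpf_ord:
  assumes "x \<in> carrier G - {\<one>}"
  shows "inj_on (\<lambda>i::int. x [^] i) {0..<int (lpf_ord x)}"
proof (rule inj_onI, rule ccontr)
  fix i j :: int
  assume ij: "i \<in> {0..<int (lpf_ord x)}" "j \<in> {0..<int (lpf_ord x)}" "x [^] i = x [^] j" "i \<noteq> j"
  have "\<bar>i - j\<bar> < int (lpf_ord x)"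
    using ij(1,2) by auto
  then have "x [^] (i - j) \<noteq> \<one>"
    using assms ij(4) by (intro int_pow_neq_one_if_less_lpf_ord) auto
  then show False
    using assms ij(3) by (simp add: int_pow_diff)
qed

section \<open>Discrete logarithms\<close>

definition cyclic_generator :: "'a set \<Rightarrow> 'a" where
  "cyclic_generator C = (SOME c. c \<in> carrier G \<and> generate G {c} = C)"

text \<open>The choice of \<open>u\<close> matters only modulo \<open>ord x\<close>.\<close>

definition dlog :: "'a \<Rightarrow> int" where
  "dlog x = (SOME u. cyclic_generator (generate G {x}) [^] u = x)"

lemma
  assumes "x \<in> carrier G"
  shows cyclic_generator_closed: "cyclic_generator (generate G {x}) \<in> carrier G"
    and generate_cyclic_generator: "generate G {cyclic_generator (generate G {x})} = generate G {x}"
  using someI[of "\<lambda>c. c \<in> carrier G \<and> generate G {c} = generate G {x}" x] assms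
  unfolding cyclic_generator_def by auto

lemma cyclic_generator_pow_dlog:
  assumes "x \<in> carrier G"
  shows "cyclic_generator (generate G {x}) [^] dlog x = x"
proof -
  let ?c = "cyclic_generator (generate G {x})"
  have "x \<in> generate G {?c}"
    using assms by (simp add: generate_cyclic_generator generate.incl)
  then have "\<exists>u::int. ?c [^] u = x"
    unfolding generate_pow[OF cyclic_generator_closed[OF assms]] by (auto intro: sym)
  then show ?thesis
    unfolding dlog_def by (rule someI_ex)
qed

lemma ord_cyclic_generator:
  "x \<in> carrier G \<Longrightarrow> ord (cyclic_generator (generate G {x})) = ord x"
  by (intro ord_eq_if_generate_eq cyclic_generator_closed generate_cyclic_generator)

lemma coprime_dlog:
  assumes "x \<in> carrier G"
  shows "coprime (dlog x) (int (ord x))"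
  using generate_int_pow_eq_iff[of "cyclic_generator (generate G {x})" "dlog x"] assms
  by (simp add: cyclic_generator_closed generate_cyclic_generator cyclic_generator_pow_dlog
      ord_cyclic_generator)

lemma dlog_int_pow:
  assumes x: "x \<in> carrier G" and e: "coprime e (int (ord x))"
  shows "[dlog (x [^] e) = e * dlog x] (mod int (ord x))"
proof -
  let ?c = "cyclic_generator (generate G {x})"
  have "generate G {x [^] e} = generate G {x}"
    using x e by (simp add: generate_int_pow_eq_iff)
  then have "?c [^] dlog (x [^] e) = x [^] e"
    using x cyclic_generator_pow_dlog[of "x [^] e"] by simp
  also have "\<dots> = (?c [^] dlog x) [^] e"
    using x by (simp add: cyclic_generator_pow_dlog)
  also have "\<dots> = ?c [^] (e * dlog x)"
    using x by (simp add: int_pow_pow cyclic_generator_closed mult.commute)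
  finally show ?thesis
    using x by (simp add: int_pow_eq_iff_cong cyclic_generator_closed ord_cyclic_generator)
qed

definition power_transversal :: "nat \<Rightarrow> 'a set" where
  "power_transversal p = {t \<in> carrier G - {\<one>}. lpf_ord t = p \<and> [dlog t = 1] (mod int p)}"

lemma power_transversal_subset: "power_transversal p \<subseteq> carrier G - {\<one>}"
  by (auto simp: power_transversal_def)

lemma power_transversal_iff_dlog_int_pow:
  assumes t: "t \<in> carrier G - {\<one>}" and e: "e \<noteq> 0" "\<bar>e\<bar> < int (lpf_ord t)"
  shows "t \<in> power_transversal (lpf_ord t) \<longleftrightarrow> [e = dlog (t [^] e)] (mod int (lpf_ord t))"
proof -
  let ?p = "int (lpf_ord t)"
  have p: "?p dvd int (ord t)"
    using lpf_ord_dvd_ord[OF t] by simp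
  have coprime_ord: "coprime e (int (ord t))"
    using e by (rule coprime_if_less_least_prime_factor)
  then have "[dlog (t [^] e) = e * dlog t] (mod ?p)"
    using t p by (auto intro: dlog_int_pow cong_dvd_modulus)
  moreover have "[dlog t = 1] (mod ?p) \<longleftrightarrow> [e * dlog t = e * 1] (mod ?p)"
    using coprime_divisors[OF dvd_refl p coprime_ord] by (simp only: cong_mult_lcancel)
  ultimately show ?thesis
    using t by (auto simp: power_transversal_def cong_def)
qed

lemma card_power_transversal_roots:
  assumes h: "h \<in> carrier G - {\<one>}" and e: "e \<noteq> 0" "\<bar>e\<bar> < int p"
  shows "card {t \<in> power_transversal p. t [^] e = h} =
           of_bool (lpf_ord h = p \<and> [e = dlog h] (mod int p))"
proof -
  let ?X = "{x \<in> carrier G. coprime e (int (ord x))}"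
  have coprime_ord: "t \<in> ?X" if "t \<in> carrier G" "lpf_ord t = p" for t
    using that e coprime_if_less_least_prime_factor[of e "ord t"] by simp
  have transversal: "t \<in> ?X \<and> lpf_ord t = p" if "t \<in> power_transversal p" for t
    using that coprime_ord by (auto simp: power_transversal_def)
  show ?thesis
  proof (cases "lpf_ord h = p")
    case True
    then obtain t where t: "t \<in> ?X" "h = t [^] e"
      using bij_betw_imp_surj_on[OF bij_betw_int_pow_coprime[of e]] coprime_ord[of h] h by auto
    have "t \<noteq> \<one>" "ord h = ord t"
      using t h by (auto simp: ord_int_pow_coprime)
    then have "t \<in> power_transversal p \<longleftrightarrow> [e = dlog h] (mod int p)"
      using power_transversal_iff_dlog_int_pow[of t e] t e True by auto
    moreover have "s = t" if "s \<in> power_transversal p" "s [^] e = h" for s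
      using bij_betw_imp_inj_on[OF bij_betw_int_pow_coprime[of e]] transversal[OF that(1)] that(2) t
      by (auto dest: inj_onD)
    ultimately have "{t \<in> power_transversal p. t [^] e = h} =
        (if [e = dlog h] (mod int p) then {t} else {})"
      using t(2) by auto
    then show ?thesis
      using True by simp
  next
    case False
    then have no_root: "{t \<in> power_transversal p. t [^] e = h} = {}"
      using transversal ord_int_pow_coprime by auto
    show ?thesis
      unfolding no_root using False by simp
  qed
qed

lemma count_sum_int_pow_transversal:
  assumes fin: "finite (carrier G)" and h: "h \<in> carrier G - {\<one>}"
    and small: "\<And>e. e \<in># E \<Longrightarrow> e \<noteq> 0 \<and> \<bar>e\<bar> < int p"
  shows "count (\<Sum>t\<in>power_transversal p. image_mset (\<lambda>e. t [^] e) E) h =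
           (if lpf_ord h = p then count (image_mset (\<lambda>e. e mod int p) E) (dlog h mod int p) else 0)"
  using small
proof (induction E)
  case (add e E)
  let ?T = "power_transversal p"
  have "count (\<Sum>t\<in>?T. image_mset (\<lambda>e. t [^] e) (add_mset e E)) h =
      (\<Sum>t\<in>?T. of_bool (t [^] e = h)) + count (\<Sum>t\<in>?T. image_mset (\<lambda>e. t [^] e) E) h"
    by (simp add: count_sum of_bool_def flip: sum.distrib) (auto intro: sum.cong)
  also have "(\<Sum>t\<in>?T. of_bool (t [^] e = h)) = card {t \<in> ?T. t [^] e = h}"
    using fin finite_subset[OF power_transversal_subset[of p]] by (simp add: Int_def sum_of_bool_eq)
  also have "\<dots> = of_bool (lpf_ord h = p \<and> [e = dlog h] (mod int p))"
    using add.prems by (intro card_power_transversal_roots[OF h]) auto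
  finally show ?case
    using add by (auto simp: cong_def)
qed simp

section \<open>Lifting\<close>

definition power_lift :: "nat \<Rightarrow> int set multiset \<Rightarrow> 'a set multiset" where
  "power_lift p F = (\<Sum>t\<in>power_transversal p. image_mset ((`) (\<lambda>i::int. t [^] i)) F)"

lemma inj_on_int_pow_power_transversal:
  assumes "t \<in> power_transversal p" "I \<subseteq> {0..<int p}"
  shows "inj_on (\<lambda>i::int. t [^] i) I"
  using assms inj_on_subset[OF inj_on_int_pow_lpf_ord[of t]] by (auto simp: power_transversal_def)

lemma family_diffs_power_lift:
  assumes "\<And>I. I \<in># F \<Longrightarrow> I \<subseteq> {0..<int p}"
  shows "family_diffs G (power_lift p F) =
           (\<Sum>t\<in>power_transversal p. image_mset (\<lambda>i. t [^] i) (family_diffs integer_group F))"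
  unfolding power_lift_def sum_mset_sum
proof (intro sum.cong refl family_diffs_image)
  fix t i j and I :: "int set"
  assume "t \<in> power_transversal p"
  then have "t \<in> carrier G"
    using power_transversal_subset by auto
  then show "t [^] i \<otimes> inv (t [^] j) = t [^] (i \<otimes>\<^bsub>integer_group\<^esub> inv\<^bsub>integer_group\<^esub> j)"
    by (simp add: int_pow_diff)
qed (use assms inj_on_int_pow_power_transversal in blast)

lemma family_points_power_lift:
  assumes "\<And>I. I \<in># F \<Longrightarrow> I \<subseteq> {0..<int p}"
  shows "family_points (power_lift p F) =
           (\<Sum>t\<in>power_transversal p. image_mset (\<lambda>i. t [^] i) (family_points F))"
  unfolding power_lift_def sum_mset_sum
  using assms inj_on_int_pow_power_transversal by (intro sum.cong refl family_points_image) blast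

lemma power_lift_block:
  assumes fin: "finite (carrier G)" and F: "\<And>I. I \<in># F \<Longrightarrow> I \<subseteq> {0..<int p}"
    and B: "B \<in># power_lift p F"
  obtains t I where "t \<in> power_transversal p" "I \<in># F" "B = (\<lambda>i. t [^] i) ` I" "card B = card I"
proof -
  obtain t I where tI: "t \<in> power_transversal p" "I \<in># F" "B = (\<lambda>i. t [^] i) ` I"
    using B finite_subset[OF power_transversal_subset[of p]] fin
    by (auto simp: power_lift_def set_mset_sum)
  then show ?thesis
    using that card_image[OF inj_on_int_pow_power_transversal[OF tI(1) F[OF tI(2)]]] by auto
qed

lemma dlog_mod_lpf_ord:
  assumes h: "h \<in> carrier G - {\<one>}"
  shows "dlog h mod int (lpf_ord h) \<in> carrier (integer_mod_group (lpf_ord h)) - {0}"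
proof -
  have "\<not> int (lpf_ord h) dvd dlog h"
    using coprime_dlog[of h] prime_lpf_ord[OF h] lpf_ord_dvd_ord[OF h] h
    by (metis Diff_iff coprime_common_divisor int_dvd_int_iff not_prime_unit prime_nat_int_transfer)
  then show ?thesis
    using prime_gt_0_nat[OF prime_lpf_ord[OF h]]
    by (auto simp: carrier_integer_mod_group dvd_eq_mod_eq_0)
qed

lemma count_family_diffs_power_lift:
  assumes fin: "finite (carrier G)" and h: "h \<in> carrier G - {\<one>}"
    and df: "difference_family (integer_mod_group p) p k l F"
  shows "count (family_diffs G (power_lift p F)) h = (if lpf_ord h = p then l else 0)"
proof -
  let ?Z = "integer_mod_group p"
  let ?E = "family_diffs integer_group F"
  note block_subset = difference_family_integer_mod_group_block_subset[OF df]
  have small: "e \<noteq> 0 \<and> \<bar>e\<bar> < int p" if e: "e \<in># ?E" for e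
  proof -
    obtain I i j where I: "I \<in># F" "i \<in> I" "j \<in> I" "i \<noteq> j" "e = i - j"
      using e by (auto elim: diff_list_elem)
    then have "i \<in> {0..<int p}" "j \<in> {0..<int p}"
      using block_subset by blast+
    then show ?thesis
      using I(4,5) by auto
  qed
  have "family_diffs G (power_lift p F) =
      (\<Sum>t\<in>power_transversal p. image_mset (\<lambda>e. t [^] e) ?E)"
    using block_subset by (rule family_diffs_power_lift)
  moreover have "family_diffs ?Z F = image_mset (\<lambda>e. e mod int p) ?E"
    using difference_family_block_subset[OF df] by (rule family_diffs_integer_mod_group)
  ultimately have "count (family_diffs G (power_lift p F)) h =
      (if lpf_ord h = p then count (family_diffs ?Z F) (dlog h mod int p) else 0)"
    using count_sum_int_pow_transversal[of h ?E p, OF fin h small] by (simp only:)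
  also have "\<dots> = (if lpf_ord h = p then l else 0)"
    using difference_family_count_diffs[OF df] dlog_mod_lpf_ord[OF h] by auto
  finally show ?thesis .
qed

lemma set_family_points_power_lift:
  assumes fin: "finite (carrier G)" and F: "\<And>I. I \<in># F \<Longrightarrow> I \<subseteq> {0<..<int p}"
  shows "set_mset (family_points (power_lift p F)) \<subseteq> carrier G - {\<one>}"
proof (rule set_family_points)
  fix B
  assume B: "B \<in># power_lift p F"
  have block_subset: "I \<subseteq> {0..<int p}" if "I \<in># F" for I
    using F[OF that] by auto
  obtain t I where t: "t \<in> power_transversal p" and I: "I \<in># F" "B = (\<lambda>i. t [^] i) ` I"
    using power_lift_block[OF fin block_subset B] by metis
  have "t [^] i \<in> carrier G - {\<one>}" if "i \<in> I" for i
  proof -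
    have "i \<noteq> 0" "\<bar>i\<bar> < int (lpf_ord t)" "t \<in> carrier G - {\<one>}"
      using t that F[OF I(1)] by (auto simp: power_transversal_def)
    then show ?thesis
      using int_pow_neq_one_if_less_lpf_ord[of t i] by auto
  qed
  then show "B \<subseteq> carrier G - {\<one>}"
    unfolding I(2) by (rule image_subsetI)
qed

lemma count_family_points_power_lift_le:
  assumes fin: "finite (carrier G)" and F: "\<And>I. I \<in># F \<Longrightarrow> I \<subseteq> {0<..<int p}"
    and count_le: "\<And>i. count (family_points F) i \<le> 1"
  shows "count (family_points (power_lift p F)) h \<le> of_bool (lpf_ord h = p)"
proof (cases "h \<in> carrier G - {\<one>}")
  case True
  have points: "i \<in> {0<..<int p}" if "i \<in># family_points F" for i
    using set_family_points[of F, OF F] that by blast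
  have small: "i \<noteq> 0 \<and> \<bar>i\<bar> < int p" if "i \<in># family_points F" for i
    using points[OF that] by auto
  have "i mod int p = i" if "i \<in># family_points F" for i
    using points[OF that] by simp
  then have "image_mset (\<lambda>i. i mod int p) (family_points F) = family_points F"
    by (metis (no_types, lifting) image_mset_cong multiset.map_ident)
  moreover have "I \<subseteq> {0..<int p}" if "I \<in># F" for I
    using F[OF that] by auto
  then have "family_points (power_lift p F) =
      (\<Sum>t\<in>power_transversal p. image_mset (\<lambda>i. t [^] i) (family_points F))"
    by (rule family_points_power_lift)
  ultimately have "count (family_points (power_lift p F)) h =
      (if lpf_ord h = p then count (family_points F) (dlog h mod int p) else 0)"
    using count_sum_int_pow_transversal[OF fin True small] by (simp only:)
  then show ?thesis
    using count_le by simp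
next
  case False
  then show ?thesis
    using set_family_points_power_lift[OF fin F] by (metis not_in_iff subsetD zero_le)
qed

definition lifted_family :: "(nat \<Rightarrow> int set multiset) \<Rightarrow> 'a set multiset" where
  "lifted_family F = (\<Sum>p\<in>prime_factors (order G). power_lift p (F p))"

lemma lpf_ord_prime_factor:
  assumes "finite (carrier G)" "h \<in> carrier G - {\<one>}"
  shows "lpf_ord h \<in> prime_factors (order G)"
proof -
  have "lpf_ord h dvd order G"
    using assms lpf_ord_dvd_ord ord_dvd_group_order by (blast intro: dvd_trans)
  then show ?thesis
    using assms prime_lpf_ord order_gt_0_iff_finite by (auto simp: in_prime_factors_iff)
qed

lemma difference_family_lifted_family:
  assumes fin: "finite (carrier G)"
    and F: "\<And>p. p \<in> prime_factors (order G) \<Longrightarrow>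
              difference_family (integer_mod_group p) p k l (F p)"
  shows "difference_family G (order G) k l (lifted_family F)"
proof -
  have block: "B \<subseteq> carrier G \<and> card B = k" if B: "B \<in># lifted_family F" for B
  proof -
    obtain p where p: "p \<in> prime_factors (order G)" "B \<in># power_lift p (F p)"
      using B by (auto simp: lifted_family_def set_mset_sum)
    note block_subset = difference_family_integer_mod_group_block_subset[OF F[OF p(1)]]
    obtain t I where "t \<in> power_transversal p" "I \<in># F p" "B = (\<lambda>i. t [^] i) ` I" "card B = card I"
      using power_lift_block[OF fin block_subset p(2)] by blast
    then show ?thesis
      using difference_family_card_block[OF F[OF p(1)]] power_transversal_subset by auto
  qed
  have "count (family_diffs G (lifted_family F)) h = l" if h: "h \<in> carrier G - {\<one>}" for h
  proof -
    have "count (family_diffs G (lifted_family F)) h =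
        (\<Sum>p\<in>prime_factors (order G). count (family_diffs G (power_lift p (F p))) h)"
      by (simp only: lifted_family_def sum_mset_sum count_sum)
    also have "\<dots> = (\<Sum>p\<in>prime_factors (order G). if lpf_ord h = p then l else 0)"
      using F by (intro sum.cong refl count_family_diffs_power_lift[OF fin h])
    also have "\<dots> = l"
      using lpf_ord_prime_factor[OF fin h] by simp
    finally show ?thesis .
  qed
  with block show ?thesis
    using fin by (simp add: difference_family_def is_group)
qed

lemma disjoint_difference_family_lifted_family:
  assumes fin: "finite (carrier G)"
    and F: "\<And>p. p \<in> prime_factors (order G) \<Longrightarrow>
              disjoint_difference_family (integer_mod_group p) p k l (F p)"
    and nonzero: "\<And>p I. p \<in> prime_factors (order G) \<Longrightarrow> I \<in># F p \<Longrightarrow> 0 \<notin> I"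
  shows "disjoint_difference_family G (order G) k l (lifted_family F)"
proof -
  let ?P = "prime_factors (order G)"
  have df: "difference_family (integer_mod_group p) p k l (F p)"
    and count_le: "count (family_points (F p)) i \<le> 1" if "p \<in> ?P" for p i
    using F[OF that] by (auto simp: disjoint_difference_family_iff_count)
  have block_subset: "I \<subseteq> {0<..<int p}" if "p \<in> ?P" "I \<in># F p" for p I
  proof
    fix i
    assume "i \<in> I"
    then have "i \<in> {0..<int p}" "i \<noteq> 0"
      using difference_family_integer_mod_group_block_subset[OF df] nonzero that by blast+
    then show "i \<in> {0<..<int p}"
      by auto
  qed
  have "count (family_points (lifted_family F)) h \<le> 1" for h
  proof -
    have "count (family_points (lifted_family F)) h =
        (\<Sum>p\<in>?P. count (family_points (power_lift p (F p))) h)"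
      by (simp only: lifted_family_def sum_mset_sum count_sum)
    also have "\<dots> \<le> (\<Sum>p\<in>?P. of_bool (lpf_ord h = p))"
      using count_le block_subset by (intro sum_mono count_family_points_power_lift_le[OF fin])
    also have "\<dots> \<le> 1"
      by (simp add: of_bool_def)
    finally show ?thesis .
  qed
  then show ?thesis
    using difference_family_lifted_family[OF fin df]
    by (simp add: disjoint_difference_family_iff_count)
qed

lemma difference_family_if_prime_factors:
  assumes "finite (carrier G)"
    and "\<And>p. p \<in> prime_factors (order G) \<Longrightarrow> ex_difference_family p k l"
  obtains F where "difference_family G (order G) k l F"
proof -
  have "\<exists>F. difference_family (integer_mod_group p) p k l F" if "p \<in> prime_factors (order G)" for p
    using assms(2)[OF that] that by (auto elim: ex_difference_family_integer_mod_group)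
  then obtain F where "difference_family (integer_mod_group p) p k l (F p)"
    if "p \<in> prime_factors (order G)" for p
    by metis
  then show ?thesis
    using that difference_family_lifted_family[OF assms(1)] by blast
qed

lemma disjoint_difference_family_if_prime_factors:
  assumes "finite (carrier G)" "l > 0" "l \<noteq> k"
    and "\<And>p. p \<in> prime_factors (order G) \<Longrightarrow> ex_disjoint_difference_family p k l"
  obtains F where "disjoint_difference_family G (order G) k l F"
proof -
  have "\<exists>F. disjoint_difference_family (integer_mod_group p) p k l F \<and> (\<forall>I\<in>#F. 0 \<notin> I)"
    if "p \<in> prime_factors (order G)" for p
    using ex_disjoint_difference_family_integer_mod_group[OF assms(4)[OF that] _ assms(2,3)] that
    by (metis in_prime_factors_imp_prime)
  then obtain F where "disjoint_difference_family (integer_mod_group p) p k l (F p)"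
      "\<forall>I\<in>#F p. 0 \<notin> I"
    if "p \<in> prime_factors (order G)" for p
    by metis
  then show ?thesis
    by (intro that[of "lifted_family F"] disjoint_difference_family_lifted_family[OF assms(1)]) auto
qed

lemma disjoint_difference_family_if_order_le_block_size:
  assumes "finite (carrier G)" "order G \<le> k" "l > 0"
    and "\<And>p. p \<in> prime_factors (order G) \<Longrightarrow> ex_difference_family p k l"
  obtains F where "disjoint_difference_family G (order G) k k F"
proof (cases "order G = 1")
  case True
  then obtain x where "carrier G = {x}"
    by (auto simp: order_def card_1_singleton_iff)
  then have "carrier G - {\<one>} = {}"
    using one_closed by (metis Diff_cancel singletonD)
  then have "disjoint_difference_family G (order G) k k {#}"
    using assms(1) by (auto simp: disjoint_difference_family_def difference_family_def is_group)
  then show ?thesis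
    by (rule that)
next
  case False
  then obtain p where p: "prime p" "p dvd order G"
    using prime_factor_nat by blast
  have "order G > 0"
    using assms(1) order_gt_0_iff_finite by blast
  then have "ex_difference_family p k l" "p \<le> order G"
    using assms(4) p by (auto simp: in_prime_factors_iff dvd_imp_le)
  then have "k \<le> order G"
    using prime_gt_1_nat[OF p(1)] \<open>l > 0\<close> unfolding ex_difference_family_def
    by (meson difference_family_block_size_le le_trans)
  then have "order G = k"
    using assms(2) by simp
  then show ?thesis
    using that disjoint_difference_family_carrier[OF is_group assms(1) refl] by auto
qed

end

theorem theorem2:
  fixes G :: "('a, 'm) monoid_scheme" (structure)
    and v k l :: nat
  assumes "group G" and "finite (carrier G)" and "order G = v"
    and "k > 0" and "l > 0"
  shows "((\<forall>p. prime p \<and> p dvd v \<longrightarrow> ex_difference_family p k l) \<longrightarrow>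
            (\<exists>F. difference_family G v k l F)) \<and>
         ((l = k \<longrightarrow> v \<le> k) \<longrightarrow>
            (\<forall>p. prime p \<and> p dvd v \<longrightarrow> ex_disjoint_difference_family p k l) \<longrightarrow>
            (\<exists>F. disjoint_difference_family G v k l F))"
proof (intro conjI impI)
  interpret group G by fact
  assume "\<forall>p. prime p \<and> p dvd v \<longrightarrow> ex_difference_family p k l"
  then show "\<exists>F. difference_family G v k l F"
    using difference_family_if_prime_factors[OF assms(2)] assms(3)
    by (metis in_prime_factors_iff)
next
  interpret group G by fact
  assume small: "l = k \<longrightarrow> v \<le> k"
    and "\<forall>p. prime p \<and> p dvd v \<longrightarrow> ex_disjoint_difference_family p k l"
  then have ex: "ex_disjoint_difference_family p k l" if "p \<in> prime_factors (order G)" for p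
    using that assms(3) by (simp add: in_prime_factors_iff)
  show "\<exists>F. disjoint_difference_family G v k l F"
  proof (cases "l = k")
    case True
    have "ex_difference_family p k l" if "p \<in> prime_factors (order G)" for p
      using ex[OF that]
      by (auto simp: ex_disjoint_difference_family_def ex_difference_family_def
          disjoint_difference_family_def)
    then show ?thesis
      using disjoint_difference_family_if_order_le_block_size assms(2,3,5) small True by metis
  next
    case False
    then show ?thesis
      using disjoint_difference_family_if_prime_factors ex assms(2,3,5) by metis
  qed
qed

end
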